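(* Let $u,\psi$ be entire functions on $\mathbb{C}$, and let the weighted composition operator $W_{(u,\psi)}$ be a compact power bounded operator on the Fock space $\mathcal{F}_\infty$, so that $\psi(z)=az+b$ with $a,b\in\mathbb{C}$, $|a|<1$. Let $u$ be non-vanishing on $\mathbb{C}$ and such that $u(z_0)=1$, where $z_0=\frac{b}{1-a}$. Then, in operator norm on $\mathcal{F}_\infty$, $$\lim_{n\to\infty}\Big\|\frac1n\sum_{k=1}^nW_{(u,\psi)}^k-W_{(u_\infty,z_0)}\Big\|=0,\qquad u_\infty(z)=\prod_{j=0}^\infty u(\psi^j(z)).$$
   Context: The Fock space $\mathcal{F}_\infty$ consists of all entire functions $f$ on $\mathbb{C}$ with $\|f\|_\infty=\sup_{z\in\mathbb{C}}|f(z)|e^{-\frac{|z|^2}{2}}<\infty$. For entire $u,\psi$, the weighted composition operator is $W_{(u,\psi)}f=u\cdot (f\circ\psi)$. Here $\psi^j$ denotes the $j$-th iterate of $\psi$ under composition ($\psi^0$ is the identity map), the infinite product $u_\infty(z)$ is $\lim_{n\to\infty}\prod_{j=0}^{n-1}u(\psi^j(z))$, and $W_{(u_\infty,z_0)}$ is the weighted composition operator with constant symbol $z_0$, i.e. $W_{(u_\infty,z_0)}f=f(z_0)\,u_\infty$. A bounded operator $T$ on a Banach space is power bounded if $\sup_{n\in\mathbb{N}}\|T^n\|<\infty$. *)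

theory Defs
  imports "HOL-Complex_Analysis.Complex_Analysis"
begin

definition fock_space :: "(complex \<Rightarrow> complex) set" where
  "fock_space = {f. f holomorphic_on UNIV \<and>
     bdd_above (range (\<lambda>z. cmod (f z) * exp (- ((cmod z)\<^sup>2 / 2))))}"

lemma fock_spaceI:
  assumes "f holomorphic_on UNIV" and "\<And>z. cmod (f z) \<le> C * exp ((cmod z)\<^sup>2 / 2)"
  shows "f \<in> fock_space"
proof -
  have "cmod (f z) * exp (- ((cmod z)\<^sup>2 / 2)) \<le> C" for z
    using assms(2)[of z] by (simp add: exp_minus field_simps)
  then show ?thesis
    using assms(1) unfolding fock_space_def by (auto intro!: bdd_aboveI)
qed

lemma fock_spaceE:
  assumes "f \<in> fock_space"
  obtains C where "\<And>z. cmod (f z) \<le> C * exp ((cmod z)\<^sup>2 / 2)"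
proof -
  obtain C where C: "\<And>z. cmod (f z) * exp (- ((cmod z)\<^sup>2 / 2)) \<le> C"
    using assms unfolding fock_space_def bdd_above_def by auto
  show ?thesis
    by (rule that[of C]) (use C in \<open>simp add: exp_minus field_simps\<close>)
qed

lemma fock_space_zero: "(\<lambda>_. 0) \<in> fock_space"
  by (rule fock_spaceI[where C = 0]) auto

lemma fock_space_add:
  assumes "f \<in> fock_space" "g \<in> fock_space"
  shows "(\<lambda>z. f z + g z) \<in> fock_space"
proof -
  obtain C where C: "\<And>z. cmod (f z) \<le> C * exp ((cmod z)\<^sup>2 / 2)"
    using fock_spaceE[OF assms(1)] by blast
  obtain D where D: "\<And>z. cmod (g z) \<le> D * exp ((cmod z)\<^sup>2 / 2)"
    using fock_spaceE[OF assms(2)] by blast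
  show ?thesis
  proof (rule fock_spaceI[where C = "C + D"])
    show "(\<lambda>z. f z + g z) holomorphic_on UNIV"
      using assms by (auto simp: fock_space_def intro!: holomorphic_intros)
    show "cmod (f z + g z) \<le> (C + D) * exp ((cmod z)\<^sup>2 / 2)" for z
      using norm_triangle_ineq[of "f z" "g z"] C[of z] D[of z]
      by (simp add: distrib_right)
  qed
qed

lemma fock_space_cmult:
  assumes "f \<in> fock_space"
  shows "(\<lambda>z. c * f z) \<in> fock_space"
proof -
  obtain C where C: "\<And>z. cmod (f z) \<le> C * exp ((cmod z)\<^sup>2 / 2)"
    using fock_spaceE[OF assms] by blast
  show ?thesis
  proof (rule fock_spaceI[where C = "cmod c * C"])
    show "(\<lambda>z. c * f z) holomorphic_on UNIV"
      using assms by (auto simp: fock_space_def intro!: holomorphic_intros)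
    show "cmod (c * f z) \<le> cmod c * C * exp ((cmod z)\<^sup>2 / 2)" for z
      using mult_left_mono[OF C[of z], of "cmod c"] by (simp add: norm_mult mult.assoc)
  qed
qed

typedef fock = fock_space
  morphisms fock_fun Fock
  using fock_space_zero by blast

setup_lifting type_definition_fock

instantiation fock :: real_normed_vector
begin

lift_definition zero_fock :: fock is "\<lambda>_. 0" by (rule fock_space_zero)
lift_definition plus_fock :: "fock \<Rightarrow> fock \<Rightarrow> fock" is "\<lambda>f g z. f z + g z"
  by (rule fock_space_add)
lift_definition uminus_fock :: "fock \<Rightarrow> fock" is "\<lambda>f z. - f z"
  using fock_space_cmult[of _ "-1"] by simp
lift_definition minus_fock :: "fock \<Rightarrow> fock \<Rightarrow> fock" is "\<lambda>f g z. f z - g z"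
  using fock_space_add fock_space_cmult[of _ "-1"] by fastforce
lift_definition scaleR_fock :: "real \<Rightarrow> fock \<Rightarrow> fock" is "\<lambda>c f z. c *\<^sub>R f z"
  using fock_space_cmult by (simp add: scaleR_conv_of_real)

definition norm_fock :: "fock \<Rightarrow> real" where
  "norm_fock f = (SUP z. cmod (fock_fun f z) * exp (- ((cmod z)\<^sup>2 / 2)))"
definition dist_fock :: "fock \<Rightarrow> fock \<Rightarrow> real" where
  "dist_fock f g = norm (f - g)"
definition sgn_fock :: "fock \<Rightarrow> fock" where
  "sgn_fock f = inverse (norm f) *\<^sub>R f"
definition uniformity_fock :: "(fock \<times> fock) filter" where
  "uniformity_fock = (INF e\<in>{0 <..}. principal {(f, g). dist f g < e})"
definition open_fock :: "fock set \<Rightarrow> bool" where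
  "open_fock S = (\<forall>f\<in>S. \<forall>\<^sub>F (f', g) in uniformity. f' = f \<longrightarrow> g \<in> S)"

lemma fock_weighted_le_norm: "cmod (fock_fun f z) * exp (- ((cmod z)\<^sup>2 / 2)) \<le> norm f"
  unfolding norm_fock_def
  using fock_fun[of f] by (intro cSUP_upper) (auto simp: fock_space_def)

lemma norm_fock_leI:
  assumes "\<And>z. cmod (fock_fun f z) * exp (- ((cmod z)\<^sup>2 / 2)) \<le> C"
  shows "norm f \<le> C"
  unfolding norm_fock_def using assms by (intro cSUP_least) auto

lemma fock_norm_ge_0: "0 \<le> norm (f::fock)"
  using fock_weighted_le_norm[of f 0] by (rule order_trans[rotated]) simp

instance
proof
  fix f g h :: fock and r s :: real
  show "f + g + h = f + (g + h)" "f + g = g + f" "0 + f = f" "- f + f = 0" "f - g = f + - g"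
    "r *\<^sub>R (f + g) = r *\<^sub>R f + r *\<^sub>R g" "(r + s) *\<^sub>R f = r *\<^sub>R f + s *\<^sub>R f"
    "r *\<^sub>R s *\<^sub>R f = (r * s) *\<^sub>R f" "1 *\<^sub>R f = f"
    by (transfer; auto simp: fun_eq_iff algebra_simps)+
  show "dist f g = norm (f - g)" "sgn f = inverse (norm f) *\<^sub>R f"
    "uniformity = (INF e\<in>{0 <..}. principal {(f :: fock, g). dist f g < e})"
    by (simp_all add: dist_fock_def sgn_fock_def uniformity_fock_def)
  show "open S = (\<forall>f\<in>S. \<forall>\<^sub>F (f', g) in uniformity. f' = f \<longrightarrow> g \<in> S)" for S :: "fock set"
    by (simp add: open_fock_def)
  show "(norm f = 0) = (f = 0)"
  proof
    assume n: "norm f = 0"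
    have "fock_fun f z = 0" for z
      using fock_weighted_le_norm[of f z] n by (simp add: mult_le_0_iff)
    then show "f = 0"
      by (simp add: fock_fun_inject[symmetric] zero_fock.rep_eq fun_eq_iff)
  next
    assume "f = 0"
    then show "norm f = 0"
      by (simp add: norm_fock_def zero_fock.rep_eq)
  qed
  show "norm (f + g) \<le> norm f + norm g"
  proof (rule norm_fock_leI)
    fix z
    have "cmod (fock_fun (f + g) z) * exp (- ((cmod z)\<^sup>2 / 2)) \<le>
      (cmod (fock_fun f z) + cmod (fock_fun g z)) * exp (- ((cmod z)\<^sup>2 / 2))"
      by (simp add: plus_fock.rep_eq norm_triangle_ineq)
    also have "\<dots> \<le> norm f + norm g"
      using fock_weighted_le_norm[of f z] fock_weighted_le_norm[of g z]
      by (simp add: distrib_right)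
    finally show "cmod (fock_fun (f + g) z) * exp (- ((cmod z)\<^sup>2 / 2)) \<le> norm f + norm g" .
  qed
  have le: "norm (c *\<^sub>R k) \<le> \<bar>c\<bar> * norm k" for c and k :: fock
    by (rule norm_fock_leI)
      (use fock_weighted_le_norm[of k] in \<open>simp add: scaleR_fock.rep_eq mult.assoc mult_left_mono\<close>)
  show "norm (r *\<^sub>R f) = \<bar>r\<bar> * norm f"
  proof (cases "r = 0")
    case True
    then show ?thesis using le[of 0 f] fock_norm_ge_0[of "0 *\<^sub>R f"] by simp
  next
    case False
    have "inverse r *\<^sub>R r *\<^sub>R f = f"
      using False by (transfer; auto)
    then have "norm f \<le> \<bar>inverse r\<bar> * norm (r *\<^sub>R f)"
      using le[of "inverse r" "r *\<^sub>R f"] by simp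
    then have "\<bar>r\<bar> * norm f \<le> norm (r *\<^sub>R f)"
      using False by (simp add: field_simps)
    then show ?thesis using le[of r f] by simp
  qed
qed

end

lemma fock_fun_le_norm: "cmod (fock_fun f z) \<le> norm f * exp ((cmod z)\<^sup>2 / 2)"
  using fock_weighted_le_norm[of f z] by (simp add: exp_minus field_simps)

lemma fock_fun_holomorphic: "fock_fun f holomorphic_on A"
  using fock_fun[of f] by (auto simp: fock_space_def intro: holomorphic_on_subset)

instance fock :: banach
proof
  fix X :: "nat \<Rightarrow> fock"
  assume X: "Cauchy X"
  have diff: "cmod (fock_fun (X m) z - fock_fun (X n) z) \<le> norm (X m - X n) * exp ((cmod z)\<^sup>2 / 2)"
    for m n z
    using fock_fun_le_norm[of "X m - X n" z] by (simp add: minus_fock.rep_eq)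
  have "Cauchy (\<lambda>n. fock_fun (X n) z)" for z
  proof (rule CauchyI)
    fix e :: real assume "0 < e"
    then have "0 < e * exp (- ((cmod z)\<^sup>2 / 2))" by simp
    then obtain N where N: "\<And>m n. m \<ge> N \<Longrightarrow> n \<ge> N \<Longrightarrow> norm (X m - X n) < e * exp (- ((cmod z)\<^sup>2 / 2))"
      using CauchyD[OF X] by blast
    have "cmod (fock_fun (X m) z - fock_fun (X n) z) < e" if "m \<ge> N" "n \<ge> N" for m n
      using N[OF that] diff[of m z n] by (simp add: exp_minus field_simps)
    then show "\<exists>N. \<forall>m\<ge>N. \<forall>n\<ge>N. cmod (fock_fun (X m) z - fock_fun (X n) z) < e" by blast
  qed
  then have "\<exists>l. (\<lambda>n. fock_fun (X n) z) \<longlonglongrightarrow> l" for z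
    using Cauchy_convergent_iff convergent_def by blast
  then obtain g where g: "\<And>z. (\<lambda>n. fock_fun (X n) z) \<longlonglongrightarrow> g z" by metis
  have ev: "\<exists>N. \<forall>n\<ge>N. \<forall>z. cmod (fock_fun (X n) z - g z) \<le> e * exp ((cmod z)\<^sup>2 / 2)" if e: "0 < e" for e
  proof -
    obtain N where N: "\<And>m n. m \<ge> N \<Longrightarrow> n \<ge> N \<Longrightarrow> norm (X m - X n) < e"
      using CauchyD[OF X e] by blast
    have "cmod (fock_fun (X n) z - g z) \<le> e * exp ((cmod z)\<^sup>2 / 2)" if n: "n \<ge> N" for n z
    proof (rule LIMSEQ_le_const2)
      show "(\<lambda>m. cmod (fock_fun (X n) z - fock_fun (X m) z)) \<longlonglongrightarrow> cmod (fock_fun (X n) z - g z)"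
        by (intro tendsto_intros g)
      have "cmod (fock_fun (X n) z - fock_fun (X m) z) \<le> e * exp ((cmod z)\<^sup>2 / 2)" if "m \<ge> N" for m
        by (rule order_trans[OF diff mult_right_mono[OF less_imp_le[OF N[OF n that]]]]) simp
      then show "\<exists>N. \<forall>m\<ge>N. cmod (fock_fun (X n) z - fock_fun (X m) z) \<le> e * exp ((cmod z)\<^sup>2 / 2)"
        by blast
    qed
    then show ?thesis by blast
  qed
  have "g holomorphic_on UNIV"
  proof (rule holomorphic_uniform_sequence[where f = "\<lambda>n. fock_fun (X n)"])
    fix z :: complex
    have "uniform_limit (cball z 1) (\<lambda>n. fock_fun (X n)) g sequentially"
    proof (rule uniform_limitI)
      fix e :: real assume e: "0 < e"
      define M where "M = exp ((cmod z + 1)\<^sup>2 / 2)"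
      have M: "0 < M" by (simp add: M_def)
      obtain N where N: "\<And>n w. n \<ge> N \<Longrightarrow>
          cmod (fock_fun (X n) w - g w) \<le> e / (2 * M) * exp ((cmod w)\<^sup>2 / 2)"
        using ev[of "e / (2 * M)"] e M by auto
      have "dist (fock_fun (X n) w) (g w) < e" if "n \<ge> N" "w \<in> cball z 1" for n w
      proof -
        have "cmod w \<le> cmod z + 1"
          using that(2) norm_triangle_ineq2[of w z] by (simp add: dist_norm norm_minus_commute)
        then have "exp ((cmod w)\<^sup>2 / 2) \<le> M"
          unfolding M_def by (simp add: power_mono)
        then have "e / (2 * M) * exp ((cmod w)\<^sup>2 / 2) \<le> e / (2 * M) * M"
          using e M by (intro mult_left_mono) auto
        also have "\<dots> < e" using e M by simp
        finally show ?thesis using N[OF that(1), of w] by (simp add: dist_norm)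
      qed
      then show "\<forall>\<^sub>F n in sequentially. \<forall>w\<in>cball z 1. dist (fock_fun (X n) w) (g w) < e"
        unfolding eventually_sequentially by blast
    qed
    then show "\<exists>d>0. cball z d \<subseteq> UNIV \<and> uniform_limit (cball z d) (\<lambda>n. fock_fun (X n)) g sequentially"
      by (intro exI[of _ 1]) auto
  qed (auto intro: fock_fun_holomorphic)
  moreover obtain N where N: "\<And>z. cmod (fock_fun (X N) z - g z) \<le> 1 * exp ((cmod z)\<^sup>2 / 2)"
    using ev[of 1] by auto
  have "cmod (g z) \<le> (norm (X N) + 1) * exp ((cmod z)\<^sup>2 / 2)" for z
    using norm_triangle_ineq3[of "fock_fun (X N) z" "g z"] N[of z] fock_fun_le_norm[of "X N" z]
    unfolding distrib_right by linarith
  ultimately have gF: "g \<in> fock_space" by (rule fock_spaceI)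
  have "X \<longlonglongrightarrow> Fock g"
  proof (rule LIMSEQ_I)
    fix e :: real assume "0 < e"
    then obtain N where N: "\<And>n z. n \<ge> N \<Longrightarrow>
        cmod (fock_fun (X n) z - g z) \<le> e / 2 * exp ((cmod z)\<^sup>2 / 2)"
      using ev[of "e / 2"] by auto
    have "norm (X n - Fock g) \<le> e / 2" if "n \<ge> N" for n
      by (rule norm_fock_leI)
        (use N[OF that] in \<open>simp add: minus_fock.rep_eq Fock_inverse[OF gF] exp_minus field_simps\<close>)
    then show "\<exists>N. \<forall>n\<ge>N. norm (X n - Fock g) < e"
      using \<open>0 < e\<close> by (intro exI[of _ N]) (fastforce intro: le_less_trans)
  qed
  then show "convergent X" by (auto simp: convergent_def)
qed


text \<open>
  The classes used are real, but the operators below are complex linear whenever they are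
  well defined, and neither the operator norm nor compactness depends on the scalar field.
\<close>

definition compact_operator :: "('a::real_normed_vector \<Rightarrow> 'b::real_normed_vector) \<Rightarrow> bool" where
  "compact_operator T \<longleftrightarrow> bounded_linear T \<and> compact (closure (T ` cball 0 1))"

definition power_bounded :: "('a::real_normed_vector \<Rightarrow> 'a) \<Rightarrow> bool" where
  "power_bounded T \<longleftrightarrow> bounded_linear T \<and> bdd_above (range (\<lambda>n::nat. onorm (T ^^ n)))"

text \<open>
  Unless \<open>maps_fock u \<psi>\<close> holds, \<open>wcomp u \<psi>\<close> is not the weighted composition operator,
  because \<open>Fock\<close> is unspecified outside the Fock space.
\<close>

definition maps_fock :: "(complex \<Rightarrow> complex) \<Rightarrow> (complex \<Rightarrow> complex) \<Rightarrow> bool" where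
  "maps_fock u \<psi> \<longleftrightarrow> (\<forall>f\<in>fock_space. (\<lambda>z. u z * f (\<psi> z)) \<in> fock_space)"

definition wcomp :: "(complex \<Rightarrow> complex) \<Rightarrow> (complex \<Rightarrow> complex) \<Rightarrow> fock \<Rightarrow> fock" where
  "wcomp u \<psi> f = Fock (\<lambda>z. u z * fock_fun f (\<psi> z))"

definition orbit_prod :: "(complex \<Rightarrow> complex) \<Rightarrow> (complex \<Rightarrow> complex) \<Rightarrow> nat \<Rightarrow> complex \<Rightarrow> complex" where
  "orbit_prod u \<psi> n z = (\<Prod>j<n. u ((\<psi> ^^ j) z))"

text \<open>Meaningful at \<open>z\<close> only if the sequence \<open>\<lambda>n. orbit_prod u \<psi> n z\<close> converges.\<close>

definition u_inf :: "(complex \<Rightarrow> complex) \<Rightarrow> (complex \<Rightarrow> complex) \<Rightarrow> complex \<Rightarrow> complex" where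
  "u_inf u \<psi> z = lim (\<lambda>n. orbit_prod u \<psi> n z)"

end

theory Submission
  imports Defs "HOL-Real_Asymp.Real_Asymp"
begin

text \<open>
  Testing \<open>T = wcomp u \<psi>\<close> on the normalized kernels \<open>exp (cnj w * z - |w|\<^sup>2 / 2)\<close> bounds
  \<open>Re g\<close> and \<open>Re (g + \<psi>)\<close>, where \<open>u = exp g\<close>, by quadratics, so that \<open>\<psi>\<close> is a polynomial of degree at
  most two, and an averaging argument leaves \<open>\<psi> z = a * z + b\<close> with \<open>|a| \<le> 1\<close>. If \<open>|a| = 1\<close>,
  kernels at \<open>\<psi> n\<close> tend to \<open>0\<close> pointwise while their images stay away from \<open>0\<close> in norm, which a
  compact operator on the Fock space excludes. For the limit, the powers of \<open>T\<close>, and not only their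
  Cesaro means, converge in norm to the operator \<open>f \<mapsto> f z\<^sub>0 \<cdot> u_inf\<close>.
\<close>

section \<open>Operator norms and Cesaro means\<close>

text \<open>The supremum need not be attained, but half of it is reached: if
  \<open>2 * norm (A x) < onorm A\<close> on the whole unit ball, homogeneity gives
  \<open>onorm A \<le> onorm A / 2\<close>, and then \<open>x = 0\<close> contradicts the
  assumption.\<close>

lemma onorm_near_maximizer:
  fixes A :: "'a::real_normed_vector \<Rightarrow> 'b::real_normed_vector"
  assumes "bounded_linear A"
  obtains x where "norm x \<le> 1" "onorm A \<le> 2 * norm (A x)"
proof -
  interpret A: bounded_linear A by fact
  have "\<exists>x. norm x \<le> 1 \<and> onorm A \<le> 2 * norm (A x)"
  proof (rule ccontr)
    assume *: "\<not> ?thesis"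
    have "norm (A x) \<le> onorm A / 2 * norm x" for x
    proof (cases "x = 0")
      case False
      then have "norm (inverse (norm x) *\<^sub>R x) \<le> 1" by simp
      then have "2 * norm (A (inverse (norm x) *\<^sub>R x)) < onorm A"
        using * by (meson not_le)
      then show ?thesis using False by (simp add: A.scaleR field_simps)
    qed (simp add: A.zero)
    then have "onorm A \<le> onorm A / 2"
      using onorm_pos_le[OF assms] by (intro onorm_bound) auto
    then have "onorm A \<le> 2 * norm (A 0)" using onorm_pos_le[OF assms] by simp
    moreover have "norm (0 :: 'a) \<le> 1" by simp
    ultimately show False using * by blast
  qed
  then show ?thesis using that by blast
qed

lemma cesaro_null:
  fixes X :: "nat \<Rightarrow> real"
  assumes lim: "X \<longlonglongrightarrow> 0" and pos: "\<And>k. 0 \<le> X k"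
  shows "(\<lambda>n. (1 / real n) * (\<Sum>k=1..n. X k)) \<longlonglongrightarrow> 0"
proof (rule LIMSEQ_I)
  fix e :: real assume e: "0 < e"
  obtain N where N: "\<And>k. k \<ge> N \<Longrightarrow> X k < e / 2"
    using LIMSEQ_D[OF lim, of "e / 2"] e pos by auto
  define S where "S = (\<Sum>k<N. X k)"
  have S: "0 \<le> S" unfolding S_def by (intro sum_nonneg pos)
  \<comment> \<open>Beyond \<open>m\<close> the fixed sum \<open>S\<close> contributes less than
    \<open>e / 2\<close> after division by \<open>n\<close>; each later term is below
    \<open>e / 2\<close>.\<close>
  obtain m :: nat where m: "2 * S / e < real m" using reals_Archimedean2 by blast
  have "norm ((1 / real n) * (\<Sum>k=1..n. X k) - 0) < e" if n: "n \<ge> Suc m" for n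
  proof -
    have "(\<Sum>k=1..n. X k) \<le> (\<Sum>k=1..n. (if k < N then X k else 0) + e / 2)"
      using N pos e by (intro sum_mono) (auto simp: less_imp_le not_less)
    also have "\<dots> = (\<Sum>k\<in>{k\<in>{1..n}. k < N}. X k) + real n * (e / 2)"
      by (simp add: sum.distrib sum.If_cases Int_def)
    also have "\<dots> \<le> S + real n * (e / 2)"
      unfolding S_def by (intro add_mono sum_mono2) (auto intro: pos)
    also have "S < real n * (e / 2)"
    proof -
      have "2 * S < real m * e" using m e by (simp add: field_simps)
      also have "\<dots> \<le> real n * e" using n e by (intro mult_right_mono) auto
      finally show ?thesis by simp
    qed
    finally have "(\<Sum>k=1..n. X k) < e * real n" by (simp add: mult.commute)
    then have "(\<Sum>k=1..n. X k) / real n < e" using n by (subst pos_divide_less_eq) auto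
    moreover have "0 \<le> (\<Sum>k=1..n. X k)" by (intro sum_nonneg pos)
    ultimately show ?thesis using n by simp
  qed
  then show "\<exists>no. \<forall>n\<ge>no. norm ((1 / real n) * (\<Sum>k=1..n. X k) - 0) < e" by blast
qed

lemma bounded_linear_funpow:
  fixes T :: "'a::real_normed_vector \<Rightarrow> 'a"
  assumes "bounded_linear T"
  shows "bounded_linear (T ^^ n)"
proof (induction n)
  case 0
  show ?case by (simp add: id_def bounded_linear_ident)
next
  case (Suc n)
  show ?case using bounded_linear_compose[OF assms Suc] by (simp add: o_def)
qed

lemma onorm_cesaro_mean_null:
  fixes T P :: "'a::real_normed_vector \<Rightarrow> 'a"
  assumes T: "bounded_linear T" and P: "bounded_linear P"
    and lim: "(\<lambda>n. onorm (\<lambda>f. (T ^^ n) f - P f)) \<longlonglongrightarrow> 0"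
  shows "(\<lambda>n. onorm (\<lambda>f. (1 / real n) *\<^sub>R (\<Sum>k=1..n. (T ^^ k) f) - P f)) \<longlonglongrightarrow> 0"
proof -
  define X where "X n = onorm (\<lambda>f. (T ^^ n) f - P f)" for n
  define M where "M n f = (1 / real n) *\<^sub>R (\<Sum>k=1..n. (T ^^ k) f) - P f" for n f
  have D: "bounded_linear (\<lambda>f. (T ^^ n) f - P f)" for n
    by (intro bounded_linear_sub bounded_linear_funpow T P)
  have X0: "0 \<le> X n" for n unfolding X_def by (rule onorm_pos_le[OF D])
  have M: "bounded_linear (M n)" for n unfolding M_def
    by (intro bounded_linear_sub bounded_linear_const_scaleR bounded_linear_sum
        bounded_linear_funpow T P)
  \<comment> \<open>For \<open>n \<ge> 1\<close>, \<open>P\<close> is the mean of \<open>n\<close>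
    copies of itself. At \<open>n = 0\<close> the mean is \<open>0\<close>, so
    \<open>M 0 = - P\<close> and the bound may fail.\<close>
  have "onorm (M n) \<le> (1 / real n) * (\<Sum>k=1..n. X k)" if "n \<ge> 1" for n
  proof (rule onorm_bound)
    show "0 \<le> (1 / real n) * (\<Sum>k=1..n. X k)" by (intro mult_nonneg_nonneg sum_nonneg X0) auto
    fix f
    have "M n f = (1 / real n) *\<^sub>R (\<Sum>k=1..n. (T ^^ k) f - P f)"
      using that unfolding M_def by (simp add: sum_subtractf scaleR_right_diff_distrib sum_constant_scaleR)
    also have "norm \<dots> \<le> (1 / real n) * (\<Sum>k=1..n. X k * norm f)"
      using onorm[OF D] by (auto simp: X_def intro!: mult_left_mono sum_norm_le divide_right_mono)
    also have "\<dots> = (1 / real n) * (\<Sum>k=1..n. X k) * norm f"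
      by (simp add: sum_distrib_right)
    finally show "norm (M n f) \<le> (1 / real n) * (\<Sum>k=1..n. X k) * norm f" .
  qed
  then have le: "\<forall>\<^sub>F n in sequentially. norm (onorm (M n)) \<le> (1 / real n) * (\<Sum>k=1..n. X k)"
    using onorm_pos_le[OF M] unfolding eventually_sequentially by fastforce
  have "(\<lambda>n. onorm (M n)) \<longlonglongrightarrow> 0"
    by (rule Lim_null_comparison[OF le cesaro_null]) (use lim X0 in \<open>simp_all add: X_def\<close>)
  then show ?thesis by (simp add: M_def[abs_def])
qed

section \<open>Compact operators and pointwise convergence\<close>

lemma compact_operator_subseq:
  assumes "compact_operator T" and "\<And>n::nat. norm (h n) \<le> C"
  obtains l r where "strict_mono r" "(\<lambda>n. T (h (r n))) \<longlonglongrightarrow> l"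
proof -
  interpret bounded_linear T using assms(1) by (simp add: compact_operator_def)
  define c where "c = \<bar>C\<bar> + 1"
  have c: "0 < c" by (simp add: c_def)
  have cball: "inverse c *\<^sub>R h n \<in> cball 0 1" for n
    using assms(2)[of n] c by (simp add: c_def field_simps)
  have mem: "\<forall>n. T (inverse c *\<^sub>R h n) \<in> closure (T ` cball 0 1)"
    by (intro allI subsetD[OF closure_subset] imageI cball)
  have "seq_compact (closure (T ` cball 0 1))"
    using assms(1) by (simp add: compact_operator_def compact_imp_seq_compact)
  then obtain l r where r: "strict_mono r" "((\<lambda>n. T (inverse c *\<^sub>R h n)) \<circ> r) \<longlonglongrightarrow> l"
    using seq_compactE[OF _ mem] by metis
  have "(\<lambda>n. c *\<^sub>R T (inverse c *\<^sub>R h (r n))) \<longlonglongrightarrow> c *\<^sub>R l"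
    using r(2) by (intro tendsto_intros) (simp add: o_def)
  then show ?thesis using that r(1) c by (simp add: scaleR)
qed

lemma tendsto_fock_fun:
  assumes "X \<longlonglongrightarrow> l"
  shows "(\<lambda>n. fock_fun (X n) z) \<longlonglongrightarrow> fock_fun l z"
proof -
  have "(\<lambda>n. norm (X n - l) * exp ((cmod z)\<^sup>2 / 2)) \<longlonglongrightarrow> 0"
    by (intro tendsto_mult_left_zero tendsto_norm_zero LIM_zero assms)
  moreover have "\<forall>n. cmod (fock_fun (X n) z - fock_fun l z) \<le> norm (X n - l) * exp ((cmod z)\<^sup>2 / 2)"
    using fock_fun_le_norm[of "X _ - l" z] by (simp add: minus_fock.rep_eq)
  ultimately have "(\<lambda>n. fock_fun (X n) z - fock_fun l z) \<longlonglongrightarrow> 0"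
    by (rule Lim_null_comparison[OF always_eventually, rotated])
  then show ?thesis by (simp add: LIM_zero_iff)
qed

text \<open>Images staying away from \<open>0\<close> along a subsequence would, by compactness,
  have a norm-convergent further subsequence. Evaluations are continuous, so its limit vanishes at
  every point and is \<open>0\<close>.\<close>

lemma compact_operator_pointwise_null:
  fixes T :: "'a::real_normed_vector \<Rightarrow> fock"
  assumes T: "compact_operator T" and h: "\<And>n. norm (h n) \<le> C"
    and z: "\<And>z. (\<lambda>n. fock_fun (T (h n)) z) \<longlonglongrightarrow> 0"
  shows "(\<lambda>n. T (h n)) \<longlonglongrightarrow> 0"
proof (rule ccontr)
  assume "\<not> ?thesis"
  then obtain e where e: "0 < e" "\<not> (\<forall>\<^sub>F n in sequentially. dist (T (h n)) 0 < e)"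
    unfolding tendsto_iff by blast
  obtain r :: "nat \<Rightarrow> nat" where r: "strict_mono r" "\<And>n. \<not> dist (T (h (r n))) 0 < e"
    using not_eventually_sequentiallyD[OF e(2)] by metis
  obtain l s where s: "strict_mono s" "(\<lambda>n. T (h (r (s n)))) \<longlonglongrightarrow> l"
    using compact_operator_subseq[OF T, of "\<lambda>n. h (r n)" C] h by blast
  have "fock_fun l z = 0" for z
  proof (rule LIMSEQ_unique[OF tendsto_fock_fun[OF s(2)]])
    show "(\<lambda>n. fock_fun (T (h (r (s n)))) z) \<longlonglongrightarrow> 0"
      using LIMSEQ_subseq_LIMSEQ[OF z strict_mono_o[OF r(1) s(1)]] by (simp add: o_def)
  qed
  then have "l = 0" by (simp add: fock_fun_inject[symmetric] zero_fock.rep_eq fun_eq_iff)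
  with s(2) e(1) have "\<forall>\<^sub>F n in sequentially. dist (T (h (r (s n)))) 0 < e"
    unfolding tendsto_iff by blast
  then show False using r(2) by (auto simp: eventually_sequentially)
qed

text \<open>One constant serves the whole unit ball, so \<open>f\<close> may later vary with the
  index. Discs of radius 1 about points of \<open>cball z\<^sub>0 1\<close> stay within modulus
  \<open>|z\<^sub>0| + 2\<close>, where all these \<open>f\<close> are bounded by \<open>L\<close>;
  Cauchy's inequality does the rest.\<close>

lemma fock_fun_lipschitz:
  obtains L where "\<And>f w. norm f \<le> 1 \<Longrightarrow> w \<in> cball z\<^sub>0 1 \<Longrightarrow>
    cmod (fock_fun f w - fock_fun f z\<^sub>0) \<le> L * cmod (w - z\<^sub>0)"
proof -
  define L where "L = exp ((cmod z\<^sub>0 + 2)\<^sup>2 / 2)"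
  have "cmod (fock_fun f w - fock_fun f z\<^sub>0) \<le> L * cmod (w - z\<^sub>0)"
    if f: "norm f \<le> 1" and w: "w \<in> cball z\<^sub>0 1" for f w
  proof (rule field_differentiable_bound[where S = "cball z\<^sub>0 1"])
    fix x assume x: "x \<in> cball z\<^sub>0 1"
    show "(fock_fun f has_field_derivative deriv (fock_fun f) x) (at x within cball z\<^sub>0 1)"
      using holomorphic_derivI[OF fock_fun_holomorphic open_UNIV]
      by (auto intro: has_field_derivative_at_within)
    have "cmod ((deriv ^^ 1) (fock_fun f) x) \<le> fact 1 * L / 1 ^ 1"
    proof (rule Cauchy_inequality)
      show "continuous_on (cball x 1) (fock_fun f)"
        by (intro holomorphic_on_imp_continuous_on fock_fun_holomorphic)
      fix y assume "cmod (x - y) = 1"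
      then have "cmod y \<le> cmod z\<^sub>0 + 2"
        using x norm_triangle_ineq2[of y x] norm_triangle_ineq2[of x z\<^sub>0]
        by (simp add: dist_norm norm_minus_commute)
      then have "exp ((cmod y)\<^sup>2 / 2) \<le> L" unfolding L_def by (simp add: power_mono)
      moreover have "norm f * exp ((cmod y)\<^sup>2 / 2) \<le> 1 * exp ((cmod y)\<^sup>2 / 2)"
        using f by (intro mult_right_mono) auto
      ultimately show "cmod (fock_fun f y) \<le> L" using fock_fun_le_norm[of f y] by linarith
    qed (auto intro: fock_fun_holomorphic)
    then show "cmod (deriv (fock_fun f) x) \<le> L" by simp
  qed (use w in auto)
  then show ?thesis using that by blast
qed

section \<open>Weighted composition operators and kernel functions\<close>

lemma fock_fun_wcomp:
  assumes "maps_fock u \<psi>"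
  shows "fock_fun (wcomp u \<psi> f) z = u z * fock_fun f (\<psi> z)"
  using assms fock_fun[of f] by (simp add: wcomp_def maps_fock_def Fock_inverse)

text \<open>Peeling off the first factor matches the outermost operator in a power and, in the
  limit, gives the functional equation of \<open>u_inf\<close>.\<close>

lemma orbit_prod_Suc: "orbit_prod u \<psi> (Suc n) z = u z * orbit_prod u \<psi> n (\<psi> z)"
  unfolding orbit_prod_def
  by (subst prod.lessThan_Suc_shift) (simp add: funpow_swap1)

lemma fock_fun_wcomp_funpow:
  assumes "maps_fock u \<psi>"
  shows "fock_fun ((wcomp u \<psi> ^^ n) f) z = orbit_prod u \<psi> n z * fock_fun f ((\<psi> ^^ n) z)"
proof (induction n arbitrary: z)
  case 0
  show ?case by (simp add: orbit_prod_def)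
next
  case (Suc n)
  then show ?case
    by (simp add: fock_fun_wcomp[OF assms] orbit_prod_Suc funpow_swap1[of \<psi> n z])
qed

lemma fock_one: "(\<lambda>_. 1) \<in> fock_space"
  by (rule fock_spaceI[where C = 1]) auto

text \<open>The weighted modulus of the normalized kernel at \<open>z\<close> is
  \<open>exp (- |z - w|^2 / 2)\<close>, so both claims rest on
  \<open>|z - w|^2 \<ge> 0\<close>.\<close>

lemma exp_cnj_in_fock_space: "(\<lambda>z. exp (cnj w * z - (cmod w)\<^sup>2 / 2)) \<in> fock_space"
  and norm_fock_kernel: "norm (Fock (\<lambda>z. exp (cnj w * z - (cmod w)\<^sup>2 / 2))) \<le> 1"
proof -
  have le: "cmod (exp (cnj w * z - (cmod w)\<^sup>2 / 2)) \<le> exp ((cmod z)\<^sup>2 / 2)" for z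
  proof -
    have "Re w * Re z + Im w * Im z - ((Re w)\<^sup>2 + (Im w)\<^sup>2) / 2 \<le> ((Re z)\<^sup>2 + (Im z)\<^sup>2) / 2"
      using zero_le_power2[of "Re w - Re z"] zero_le_power2[of "Im w - Im z"]
      by (simp add: power2_diff field_simps)
    then show ?thesis by (simp add: cmod_power2)
  qed
  show *: "(\<lambda>z. exp (cnj w * z - (cmod w)\<^sup>2 / 2)) \<in> fock_space"
    by (rule fock_spaceI[where C = 1]) (use le in \<open>auto intro!: holomorphic_intros\<close>)
  show "norm (Fock (\<lambda>z. exp (cnj w * z - (cmod w)\<^sup>2 / 2))) \<le> 1"
    by (rule norm_fock_leI) (unfold Fock_inverse[OF *], use le in \<open>simp add: exp_minus field_simps\<close>)
qed

text \<open>The parameter \<open>w\<close> stays free: \<open>w = 0\<close> controls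
  \<open>u\<close>, \<open>w = 1\<close> controls \<open>u\<close> times \<open>exp \<psi>\<close>,
  and \<open>w = \<psi> z\<close> makes the left-hand side largest.\<close>

lemma wcomp_kernel_bound:
  assumes "maps_fock u \<psi>" and "bounded_linear (wcomp u \<psi>)"
  shows "cmod (u z) * exp (Re (cnj w * \<psi> z) - (cmod w)\<^sup>2 / 2) \<le> onorm (wcomp u \<psi>) * exp ((cmod z)\<^sup>2 / 2)"
proof -
  let ?k = "Fock (\<lambda>z. exp (cnj w * z - (cmod w)\<^sup>2 / 2))"
  have "cmod (u z) * exp (Re (cnj w * \<psi> z) - (cmod w)\<^sup>2 / 2) = cmod (fock_fun (wcomp u \<psi> ?k) z)"
    unfolding fock_fun_wcomp[OF assms(1)] Fock_inverse[OF exp_cnj_in_fock_space]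
    by (simp add: norm_mult)
  also have "\<dots> \<le> norm (wcomp u \<psi> ?k) * exp ((cmod z)\<^sup>2 / 2)" by (rule fock_fun_le_norm)
  also have "norm (wcomp u \<psi> ?k) \<le> onorm (wcomp u \<psi>) * norm ?k" by (rule onorm[OF assms(2)])
  also have "\<dots> \<le> onorm (wcomp u \<psi>) * 1"
    by (intro mult_left_mono norm_fock_kernel onorm_pos_le assms(2))
  finally show ?thesis by simp
qed

section \<open>Entire functions with quadratically bounded real part\<close>

text \<open>
  The Borel--Caratheodory inequality: the Schwarz lemma is applied to \<open>h / (2 * M - h)\<close>.
\<close>

lemma norm_le_of_Re_less:
  assumes h: "h holomorphic_on UNIV" and h0: "h 0 = 0" and z: "z \<noteq> 0"
    and Re: "\<And>w. cmod w < 2 * cmod z \<Longrightarrow> Re (h w) < M"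
  shows "cmod (h z) \<le> 2 * M"
proof -
  \<comment> \<open>Rescaling by \<open>2 * |z|\<close> puts \<open>z\<close> at modulus 1/2 in the
    unit disc, where the Schwarz lemma yields \<open>2 * |h z| \<le> |2 * M - h z|\<close>.\<close>
  define c where "c = 2 * cmod z"
  define \<phi> where "\<phi> \<zeta> = h (c * \<zeta>) / (2 * M - h (c * \<zeta>))" for \<zeta> :: complex
  have M: "0 < M" using Re[of 0] z by (simp add: h0)
  have c: "c > 0" using z by (simp add: c_def)
  have Re': "Re (h (c * \<zeta>)) < M" if "cmod \<zeta> < 1" for \<zeta> :: complex
    using that c by (intro Re) (simp add: norm_mult c_def)
  have ne: "2 * M - h (c * \<zeta>) \<noteq> 0" if "cmod \<zeta> < 1" for \<zeta> :: complex
  proof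
    assume "2 * M - h (c * \<zeta>) = 0"
    then have "Re (2 * M - h (c * \<zeta>)) = 0" by simp
    then show False using Re'[OF that] M by simp
  qed
  have "cmod (\<phi> (z / c)) \<le> cmod (z / c)"
  proof (rule Schwarz_Lemma(1))
    have "(\<lambda>\<zeta>. h (c * \<zeta>)) holomorphic_on ball 0 1"
      using holomorphic_on_compose_gen[of "\<lambda>\<zeta>. c * \<zeta>" "ball 0 1" h UNIV] h
      by (auto simp: o_def intro!: holomorphic_intros)
    then show "\<phi> holomorphic_on ball 0 1"
      unfolding \<phi>_def using ne by (intro holomorphic_intros) (auto simp: dist_norm)
    show "\<phi> 0 = 0" by (simp add: \<phi>_def h0)
    show "cmod (\<phi> \<zeta>) < 1" if "cmod \<zeta> < 1" for \<zeta> :: complex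
    proof -
      \<comment> \<open>The difference of the two squares is
        \<open>4 * M * (M - Re (h (c * \<zeta>)))\<close>.\<close>
      have "(cmod (h (c * \<zeta>)))\<^sup>2 < (cmod (2 * M - h (c * \<zeta>)))\<^sup>2"
        using mult_strict_left_mono[OF Re'[OF that] M]
        unfolding cmod_power2 by (simp add: power2_eq_square algebra_simps)
      then have "cmod (h (c * \<zeta>)) < cmod (2 * M - h (c * \<zeta>))"
        using power2_less_imp_less norm_ge_zero by blast
      then show ?thesis using ne[OF that] by (simp add: \<phi>_def norm_divide)
    qed
    show "cmod (z / c) < 1" using z by (simp add: norm_divide c_def)
  qed
  moreover have half: "cmod (z / c) = 1 / 2" using z by (simp add: norm_divide c_def)
  moreover have cz: "c * (z / c) = z" using c by simp
  ultimately have "cmod (h z) / cmod (2 * M - h z) \<le> 1 / 2"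
    unfolding \<phi>_def cz norm_divide[of "h z"] by metis
  moreover have "2 * M - h z \<noteq> 0" using ne[of "z / c"] unfolding half cz by simp
  ultimately have "2 * cmod (h z) \<le> cmod (2 * M - h z)"
    using pos_divide_le_eq[of "cmod (2 * M - h z)" "cmod (h z)" "1 / 2"] by simp
  also have "\<dots> \<le> 2 * M + cmod (h z)"
    using norm_triangle_ineq4[of "2 * M" "h z"] M by (simp add: norm_mult)
  finally show ?thesis by simp
qed

text \<open>Borel--Caratheodory turns the one-sided bound into
  \<open>|h z - h 0| = O(|z|^2)\<close>, and Liouville's theorem for polynomial growth
  applies.\<close>

lemma entire_quadratic_if_Re_le:
  assumes h: "h holomorphic_on UNIV" and Re: "\<And>z. Re (h z) \<le> A + (cmod z)\<^sup>2 / 2"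
  obtains c0 c1 c2 where "\<And>z. h z = c0 + c1 * z + c2 * z\<^sup>2"
proof -
  \<comment> \<open>The added 1 makes \<open>B\<close> positive and the bound on
    \<open>Re (k w)\<close> strict, as \<open>norm_le_of_Re_less\<close> demands.\<close>
  define B where "B = A - Re (h 0) + 1"
  have B: "0 < B" using Re[of 0] by (simp add: B_def)
  define k where "k z = h z - h 0" for z
  have k: "k holomorphic_on UNIV" unfolding k_def by (intro holomorphic_intros h)
  have bound: "cmod (k z) \<le> (2 * B + 4) * cmod z ^ 2" if z: "1 \<le> cmod z" for z
  proof -
    have "cmod (k z) \<le> 2 * (B + 2 * (cmod z)\<^sup>2)"
    proof (rule norm_le_of_Re_less[OF k])
      show "Re (k w) < B + 2 * (cmod z)\<^sup>2" if "cmod w < 2 * cmod z" for w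
      proof -
        have "(cmod w)\<^sup>2 \<le> (2 * cmod z)\<^sup>2" using that by (intro power_mono) auto
        then show ?thesis using Re[of w] by (simp add: k_def B_def power_mult_distrib)
      qed
    qed (use z in \<open>auto simp: k_def\<close>)
    also have "\<dots> \<le> (2 * B + 4) * cmod z ^ 2"
      using mult_left_mono[OF one_le_power[OF z, of 2], of "2 * B"] B by (simp add: algebra_simps)
    finally show ?thesis .
  qed
  have "h z = (h 0 + k 0) + deriv k 0 * z + ((deriv ^^ 2) k 0 / 2) * z\<^sup>2" for z
  proof -
    have "h z = h 0 + k z" by (simp add: k_def)
    also have "k z = (\<Sum>i\<le>2. (deriv ^^ i) k 0 / fact i * z ^ i)"
      by (rule Liouville_polynomial[OF k bound])
    also have "h 0 + \<dots> = (h 0 + k 0) + deriv k 0 * z + ((deriv ^^ 2) k 0 / 2) * z\<^sup>2"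
      by (simp add: numeral_2_eq_2)
    finally show ?thesis .
  qed
  then show ?thesis using that by blast
qed

section \<open>Affine symbols from compactness\<close>

text \<open>
  Summing over the fourth roots of unity removes the real part of the exponent of \<open>u\<close> and all
  cross terms of \<open>|\<psi>|\<^sup>2\<close>.
\<close>

lemma sum_fourth_roots:
  fixes t :: real and p q :: "complex \<Rightarrow> complex"
  assumes p: "\<And>z. p z = p0 + p1 * z + p2 * z\<^sup>2" and q: "\<And>z. q z = q0 + q1 * z + q2 * z\<^sup>2"
  shows "(\<Sum>z\<leftarrow>[of_real t, - of_real t, \<i> * of_real t, - \<i> * of_real t].
      Re (q z) + (cmod (p z))\<^sup>2 / 2) =
    4 * (Re q0 + ((cmod p0)\<^sup>2 + (cmod p1)\<^sup>2 * t ^ 2 + (cmod p2)\<^sup>2 * t ^ 4) / 2)"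
proof -
  have t4: "t ^ 4 = t * t * (t * t)" by (simp add: power4_eq_xxxx)
  show ?thesis
    unfolding p q cmod_power2 t4
    by (simp add: power2_eq_square field_simps)
qed

lemma quartic_le_quadratic:
  fixes A B C D :: real
  assumes "\<And>t. A + B * t ^ 2 + C * t ^ 4 \<le> D + t ^ 2" and "0 \<le> C" and "0 \<le> B"
  shows "C = 0" and "B \<le> 1"
proof -
  \<comment> \<open>A linear function bounded above on the half-line has slope at most 0; with
    \<open>s = t^2\<close>, both claims are brought to this form.\<close>
  have nb: "E \<le> 0" if "\<And>s. 0 \<le> s \<Longrightarrow> E * s \<le> K" for E K :: real
  proof (rule ccontr)
    assume "\<not> E \<le> 0"
    then have "E * ((\<bar>K\<bar> + 1) / E) = \<bar>K\<bar> + 1" "0 \<le> (\<bar>K\<bar> + 1) / E" by auto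
    then show False using that[of "(\<bar>K\<bar> + 1) / E"] by simp
  qed
  have s: "A + B * s + C * s\<^sup>2 \<le> D + s" if "0 \<le> s" for s
    using assms(1)[of "sqrt s"] that by (simp add: power4_eq_xxxx power2_eq_square mult.assoc)
  show C0: "C = 0"
  proof (rule ccontr)
    assume "C \<noteq> 0"
    \<comment> \<open>For \<open>s > 1\<close> the quadratic inequality is divided by
      \<open>s\<close>; the summand \<open>C\<close> in the constant covers
      \<open>s \<le> 1\<close>.\<close>
    have "C * s \<le> 1 + \<bar>D - A\<bar> + C" if "0 \<le> s" for s
    proof (cases "s \<le> 1")
      case True
      then show ?thesis using mult_left_mono[OF True assms(2)] by simp
    next
      case False
      have "0 \<le> B * s" using assms(3) that by simp
      then have "C * s * s \<le> \<bar>D - A\<bar> + s" using s[OF that] by (simp add: power2_eq_square)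
      also have "\<dots> \<le> (1 + \<bar>D - A\<bar>) * s"
        using False mult_left_mono[of 1 s "\<bar>D - A\<bar>"] by (simp add: algebra_simps)
      finally show ?thesis using False assms(2) by simp
    qed
    then have "C \<le> 0" by (rule nb)
    then show False using assms(2) \<open>C \<noteq> 0\<close> by simp
  qed
  have "(B - 1) * s \<le> D - A" if "0 \<le> s" for s
    using s[OF that] C0 by (simp add: algebra_simps)
  then have "B - 1 \<le> 0" by (rule nb)
  then show "B \<le> 1" by simp
qed

lemma wcomp_symbol_affine:
  assumes u: "u holomorphic_on UNIV" and \<psi>: "\<psi> holomorphic_on UNIV"
    and maps: "maps_fock u \<psi>" and comp: "compact_operator (wcomp u \<psi>)" and nz: "\<And>z. u z \<noteq> 0"
  obtains a b where "\<And>z. \<psi> z = a * z + b" "cmod a < 1"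
proof -
  have bl: "bounded_linear (wcomp u \<psi>)" using comp by (simp add: compact_operator_def)
  define D where "D = ln (onorm (wcomp u \<psi>) + 1)"
  have expD: "onorm (wcomp u \<psi>) \<le> exp D"
    using onorm_pos_le[OF bl] by (simp add: D_def)
  obtain g where g: "g holomorphic_on UNIV" and ug: "\<And>z. u z = exp (g z)"
    using contractible_imp_holomorphic_log[OF u] nz by (auto simp: contractible_UNIV)
  have bound: "Re (g z) + Re (cnj w * \<psi> z) \<le> D + (cmod w)\<^sup>2 / 2 + (cmod z)\<^sup>2 / 2" for z w
  proof -
    have "exp (Re (g z) + (Re (cnj w * \<psi> z) - (cmod w)\<^sup>2 / 2)) \<le>
        onorm (wcomp u \<psi>) * exp ((cmod z)\<^sup>2 / 2)"
      using wcomp_kernel_bound[OF maps bl, of z w] by (simp add: ug exp_add)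
    also have "\<dots> \<le> exp (D + (cmod z)\<^sup>2 / 2)"
      using mult_right_mono[OF expD, of "exp ((cmod z)\<^sup>2 / 2)"] by (simp add: exp_add)
    finally show ?thesis by simp
  qed
  \<comment> \<open>\<open>w = 0\<close> bounds \<open>Re g\<close>, and \<open>w = 1\<close> bounds
    \<open>Re (g + \<psi>)\<close>, with \<open>1 / 2\<close> coming from \<open>|w|^2 / 2\<close>.
    So \<open>\<psi>\<close> is a difference of two quadratics.\<close>
  obtain g0 g1 g2 where gq: "\<And>z. g z = g0 + g1 * z + g2 * z\<^sup>2"
    by (rule entire_quadratic_if_Re_le[OF g, of D]) (use bound[of _ 0] in auto)
  obtain k0 k1 k2 where kq: "\<And>z. g z + \<psi> z = k0 + k1 * z + k2 * z\<^sup>2"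
    by (rule entire_quadratic_if_Re_le[of "\<lambda>z. g z + \<psi> z" "D + 1 / 2"])
      (use bound[of _ 1] in \<open>auto intro!: holomorphic_intros g \<psi>\<close>)
  define b a p where "b = k0 - g0" and "a = k1 - g1" and "p = k2 - g2"
  have \<psi>q: "\<psi> z = b + a * z + p * z\<^sup>2" for z
    using kq[of z] gq[of z] unfolding b_def a_def p_def by (simp add: algebra_simps)
  \<comment> \<open>This is \<open>bound\<close> at the optimal \<open>w = \<psi> z\<close>.\<close>
  have bound2: "Re (g z) + (cmod (\<psi> z))\<^sup>2 / 2 \<le> D + (cmod z)\<^sup>2 / 2" for z
  proof -
    have "Re (cnj (\<psi> z) * \<psi> z) = (cmod (\<psi> z))\<^sup>2"
      unfolding cmod_power2 by (simp add: power2_eq_square)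
    then show ?thesis using bound[of z "\<psi> z"] by simp
  qed
  have quartic: "(2 * Re g0 + (cmod b)\<^sup>2) + (cmod a)\<^sup>2 * t ^ 2 + (cmod p)\<^sup>2 * t ^ 4 \<le> 2 * D + t ^ 2"
    for t :: real
    using sum_fourth_roots[OF \<psi>q gq, of t] bound2[of "of_real t"] bound2[of "- of_real t"]
      bound2[of "\<i> * of_real t"] bound2[of "- \<i> * of_real t"]
    by (simp add: norm_mult field_simps)
  have "(cmod p)\<^sup>2 = 0" and "(cmod a)\<^sup>2 \<le> 1"
    using quartic_le_quadratic[OF quartic] by simp_all
  then have p0: "p = 0" and a1: "cmod a \<le> 1" by (simp_all add: power2_le_iff_abs_le abs_square_le_1)
  have \<psi>a: "\<psi> z = a * z + b" for z using \<psi>q[of z] p0 by simp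
  have "cmod a \<noteq> 1"
  proof
    assume a: "cmod a = 1"
    \<comment> \<open>For \<open>|a| = 1\<close> the terms in \<open>|z|^2\<close> cancel in
      \<open>bound2\<close>, leaving, up to a constant, the real part of this entire
      \<open>h\<close>. It is bounded above, so \<open>exp h\<close> is bounded and hence
      constant.\<close>
    define h where "h z = g z + cnj b * a * z" for z
    have sq: "(cmod (\<psi> z))\<^sup>2 = (cmod z)\<^sup>2 + (cmod b)\<^sup>2 + 2 * Re (cnj b * a * z)" for z
    proof -
      have "(cmod (\<psi> z))\<^sup>2 = (cmod (a * z))\<^sup>2 + (cmod b)\<^sup>2 + 2 * Re (cnj b * (a * z))"
        unfolding \<psi>a cmod_power2 by (simp add: power2_eq_square field_simps)
      then show ?thesis by (simp add: norm_mult a mult.assoc)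
    qed
    have Reh: "Re (h z) = Re (g z) + (cmod (\<psi> z))\<^sup>2 / 2 - (cmod z)\<^sup>2 / 2 - (cmod b)\<^sup>2 / 2" for z
      using sq[of z] unfolding h_def plus_complex.sel by linarith
    have "Re (h z) \<le> D" for z
      using bound2[of z] Reh[of z] zero_le_power2[of "cmod b"] by linarith
    then have "cmod (exp (h z)) \<le> exp D" for z by simp
    then have "bounded (range (\<lambda>z. exp (h z)))" by (auto simp: bounded_iff)
    moreover have "(\<lambda>z. exp (h z)) holomorphic_on UNIV"
      unfolding h_def by (intro holomorphic_intros g)
    ultimately obtain m where m: "\<And>z. exp (h z) = m"
      using Liouville_theorem unfolding constant_on_def by blast
    \<comment> \<open>The kernel is centred where \<open>\<psi>\<close> sends the point
      \<open>n\<close>. Its image, evaluated at \<open>n\<close>, has weighted modulus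
      \<open>exp (Re (h n) + |b|^2 / 2)\<close>, which is at least \<open>|m|\<close>; and
      \<open>m\<close> is nonzero as a value of \<open>exp\<close>.\<close>
    define w where "w n = \<psi> (of_nat n)" for n :: nat
    define k where "k n = Fock (\<lambda>z. exp (cnj (w n) * z - (cmod (w n))\<^sup>2 / 2))" for n
    have k: "fock_fun (k n) z = exp (cnj (w n) * z - (cmod (w n))\<^sup>2 / 2)" for n z
      unfolding k_def Fock_inverse[OF exp_cnj_in_fock_space] by (rule refl)
    have le: "\<forall>n. real n - cmod b \<le> cmod (w n)"
      using norm_diff_ineq[of "a * of_nat _" b] by (simp add: w_def \<psi>a norm_mult a)
    have w: "filterlim (\<lambda>n. cmod (w n)) at_top sequentially"
      by (rule filterlim_at_top_mono[OF _ always_eventually[OF le]]) real_asymp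
    have "(\<lambda>n. wcomp u \<psi> (k n)) \<longlonglongrightarrow> 0"
    proof (rule compact_operator_pointwise_null[OF comp])
      show "norm (k n) \<le> 1" for n unfolding k_def by (rule norm_fock_kernel)
      show "(\<lambda>n. fock_fun (wcomp u \<psi> (k n)) z) \<longlonglongrightarrow> 0" for z
      proof -
        define s where "s = cmod (\<psi> z)"
        have "((\<lambda>x::real. exp (x * s - x\<^sup>2 / 2)) \<longlongrightarrow> 0) at_top" by real_asymp
        then have "(\<lambda>n. exp (cmod (w n) * s - (cmod (w n))\<^sup>2 / 2)) \<longlonglongrightarrow> 0"
          by (rule filterlim_compose[OF _ w])
        then have "(\<lambda>n. fock_fun (k n) (\<psi> z)) \<longlonglongrightarrow> 0"
        proof (rule Lim_null_comparison[rotated], intro always_eventually allI)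
          fix n
          show "cmod (fock_fun (k n) (\<psi> z)) \<le> exp (cmod (w n) * s - (cmod (w n))\<^sup>2 / 2)"
            using complex_Re_le_cmod[of "cnj (w n) * \<psi> z"]
            by (simp add: k s_def norm_mult del: complex_cnj_mult)
        qed
        then show ?thesis
          by (simp add: fock_fun_wcomp[OF maps] tendsto_mult_right_zero)
      qed
    qed
    then have "(\<lambda>n. norm (wcomp u \<psi> (k n))) \<longlonglongrightarrow> 0" by (rule tendsto_norm_zero)
    moreover have "cmod m \<le> norm (wcomp u \<psi> (k n))" for n
    proof -
      have "cmod m = exp (Re (h (of_nat n)))" using m[of "of_nat n"] by auto
      also have "\<dots> \<le> exp (Re (g (of_nat n)) + (cmod (w n))\<^sup>2 / 2 - (real n)\<^sup>2 / 2)"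
        by (simp add: Reh w_def)
      also have "\<dots> = cmod (fock_fun (wcomp u \<psi> (k n)) (of_nat n)) *
          exp (- ((cmod (of_nat n :: complex))\<^sup>2 / 2))"
      proof -
        have "Re (cnj (w n) * w n) = (cmod (w n))\<^sup>2"
          unfolding cmod_power2 by (simp add: power2_eq_square)
        then show ?thesis
          by (simp add: fock_fun_wcomp[OF maps] k ug w_def[symmetric] norm_mult
              flip: exp_add del: times_complex.sel)
      qed
      also have "\<dots> \<le> norm (wcomp u \<psi> (k n))" by (rule fock_weighted_le_norm)
      finally show ?thesis .
    qed
    ultimately have "cmod m \<le> 0" by (intro LIMSEQ_le_const) auto
    then show False using m[of 0] by auto
  qed
  then show ?thesis using that \<psi>a a1 by fastforce
qed

section \<open>Orbits of the symbol and the infinite product\<close>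

lemma funpow_affine:
  fixes a b :: complex
  assumes "\<And>z. \<psi> z = a * z + b" and "a \<noteq> 1" and "z\<^sub>0 = b / (1 - a)"
  shows "(\<psi> ^^ n) z = z\<^sub>0 + a ^ n * (z - z\<^sub>0)"
proof (induction n)
  case (Suc n)
  have b: "b = (1 - a) * z\<^sub>0" using assms(2,3) by simp
  have "(\<psi> ^^ Suc n) z = a * (z\<^sub>0 + a ^ n * (z - z\<^sub>0)) + b"
    using Suc assms(1)[of "(\<psi> ^^ n) z"] by simp
  also have "\<dots> = z\<^sub>0 + a ^ Suc n * (z - z\<^sub>0)" by (simp add: b algebra_simps)
  finally show ?case .
qed simp

text \<open>Since \<open>u\<close> is differentiable at \<open>z\<^sub>0\<close> with value 1 there,
  the factors at the orbit points differ from 1 by \<open>O(|a|^n)\<close>, so the product converges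
  absolutely.\<close>

lemma tendsto_orbit_prod:
  assumes u: "u holomorphic_on UNIV" and u0: "u z\<^sub>0 = 1" and a: "cmod a < 1"
    and orbit: "\<And>n. (\<psi> ^^ n) z = z\<^sub>0 + a ^ n * (z - z\<^sub>0)"
  shows "(\<lambda>n. orbit_prod u \<psi> n z) \<longlonglongrightarrow> u_inf u \<psi> z"
proof -
  obtain u' where u': "(u has_field_derivative u') (at z\<^sub>0)"
    using holomorphic_derivI[OF u open_UNIV] by blast
  have "\<forall>\<^sub>F w in at z\<^sub>0. cmod ((u w - u z\<^sub>0) / (w - z\<^sub>0)) < cmod u' + 1"
    using u' unfolding has_field_derivative_iff
    by (intro order_tendstoD(2)[OF tendsto_norm]) auto
  then obtain d where d: "0 < d" and
    dle: "\<And>w. w \<noteq> z\<^sub>0 \<Longrightarrow> dist w z\<^sub>0 < d \<Longrightarrow> cmod ((u w - u z\<^sub>0) / (w - z\<^sub>0)) < cmod u' + 1"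
    unfolding eventually_at by blast
  have lip: "cmod (u w - 1) \<le> (cmod u' + 1) * cmod (w - z\<^sub>0)" if "dist w z\<^sub>0 < d" for w
    using dle[OF _ that] u0 by (cases "w = z\<^sub>0") (auto simp: norm_divide field_simps less_imp_le)
  have pow: "(\<lambda>n. a ^ n * (z - z\<^sub>0)) \<longlonglongrightarrow> 0"
    using a by (intro tendsto_mult_left_zero LIMSEQ_power_zero)
  have "summable (\<lambda>n. cmod (u ((\<psi> ^^ n) z) - 1))"
  proof (rule summable_comparison_test_ev)
    have "\<forall>\<^sub>F n in sequentially. dist (a ^ n * (z - z\<^sub>0)) 0 < d"
      using pow d unfolding tendsto_iff by blast
    then show "\<forall>\<^sub>F n in sequentially. norm (cmod (u ((\<psi> ^^ n) z) - 1)) \<le>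
        (cmod u' + 1) * (cmod a ^ n * cmod (z - z\<^sub>0))"
    proof eventually_elim
      case (elim n)
      then show ?case
        using lip[of "(\<psi> ^^ n) z"] by (simp add: orbit dist_norm norm_mult norm_power)
    qed
    show "summable (\<lambda>n. (cmod u' + 1) * (cmod a ^ n * cmod (z - z\<^sub>0)))"
      using a by (intro summable_mult summable_mult2 summable_geometric) auto
  qed
  then have "convergent (\<lambda>n. \<Prod>j\<le>n. u ((\<psi> ^^ j) z))"
    by (intro convergent_prod_imp_convergent abs_convergent_prod_imp_convergent_prod
        summable_imp_abs_convergent_prod)
  then have "convergent (\<lambda>n. orbit_prod u \<psi> (Suc n) z)"
    by (simp add: orbit_prod_def lessThan_Suc_atMost)
  then have "convergent (\<lambda>n. orbit_prod u \<psi> n z)"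
    by (rule convergent_Suc_iff[THEN iffD1])
  then show ?thesis unfolding u_inf_def by (simp add: convergent_LIMSEQ_iff)
qed

section \<open>The limit operator and convergence of the powers\<close>

lemma wcomp_const_symbol:
  assumes "v \<in> fock_space"
  shows "maps_fock v (\<lambda>_. c)" and "bounded_linear (wcomp v (\<lambda>_. c))"
proof -
  show maps: "maps_fock v (\<lambda>_. c)"
    unfolding maps_fock_def using fock_space_cmult[OF assms] by (simp add: mult.commute)
  show "bounded_linear (wcomp v (\<lambda>_. c))"
  proof (rule bounded_linear_intro[where K = "exp ((cmod c)\<^sup>2 / 2) * norm (Fock v)"])
    fix f g :: fock and r :: real
    show "wcomp v (\<lambda>_. c) (f + g) = wcomp v (\<lambda>_. c) f + wcomp v (\<lambda>_. c) g"
      by (simp add: fock_fun_inject[symmetric] fun_eq_iff fock_fun_wcomp[OF maps] plus_fock.rep_eq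
          algebra_simps)
    show "wcomp v (\<lambda>_. c) (r *\<^sub>R f) = r *\<^sub>R wcomp v (\<lambda>_. c) f"
      by (simp add: fock_fun_inject[symmetric] fun_eq_iff fock_fun_wcomp[OF maps] scaleR_fock.rep_eq)
    show "norm (wcomp v (\<lambda>_. c) f) \<le> norm f * (exp ((cmod c)\<^sup>2 / 2) * norm (Fock v))"
    proof (rule norm_fock_leI)
      fix z
      have "cmod (fock_fun f c) * (cmod (v z) * exp (- ((cmod z)\<^sup>2 / 2))) \<le>
          (norm f * exp ((cmod c)\<^sup>2 / 2)) * norm (Fock v)"
        using fock_weighted_le_norm[of "Fock v" z] fock_fun_le_norm[of f c]
        by (intro mult_mono) (simp_all add: Fock_inverse[OF assms])
      then show "cmod (fock_fun (wcomp v (\<lambda>_. c) f) z) * exp (- ((cmod z)\<^sup>2 / 2)) \<le>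
          norm f * (exp ((cmod c)\<^sup>2 / 2) * norm (Fock v))"
        by (simp add: fock_fun_wcomp[OF maps] norm_mult ac_simps)
    qed
  qed
qed

lemma power_bounded_bound:
  assumes "power_bounded T"
  obtains C where "0 \<le> C" "\<And>n f. norm ((T ^^ n) f) \<le> C * norm f"
proof -
  have T: "bounded_linear T" using assms by (simp add: power_bounded_def)
  obtain C where C: "\<And>n. onorm (T ^^ n) \<le> C"
    using assms by (auto simp: power_bounded_def bdd_above_def)
  have "norm ((T ^^ n) f) \<le> C * norm f" for n f
    by (rule order_trans[OF onorm[OF bounded_linear_funpow[OF T]]]) (intro mult_right_mono C norm_ge_zero)
  moreover have "0 \<le> C" using C[of 0] onorm_pos_le[OF bounded_linear_funpow[OF T, of 0]] by simp
  ultimately show ?thesis using that by blast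
qed

text \<open>The powers applied to the constant function 1 are the orbit products. They are bounded
  in norm, so compactness gives a norm limit along a subsequence, and pointwise this limit is
  \<open>u_inf u \<psi>\<close>. Holomorphy and growth come with membership of that limit in the
  space.\<close>

lemma u_inf_in_fock_space:
  assumes maps: "maps_fock u \<psi>" and comp: "compact_operator (wcomp u \<psi>)"
    and pb: "power_bounded (wcomp u \<psi>)"
    and lim: "\<And>z. (\<lambda>n. orbit_prod u \<psi> n z) \<longlonglongrightarrow> u_inf u \<psi> z"
  shows "u_inf u \<psi> \<in> fock_space"
proof -
  define e where "e = Fock (\<lambda>_. 1)"
  have e: "fock_fun ((wcomp u \<psi> ^^ n) e) z = orbit_prod u \<psi> n z" for n z
    by (simp add: fock_fun_wcomp_funpow[OF maps] e_def Fock_inverse[OF fock_one])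
  obtain C where "\<And>n f. norm ((wcomp u \<psi> ^^ n) f) \<le> C * norm f"
    using power_bounded_bound[OF pb] by metis
  then obtain l r where r: "strict_mono r" "(\<lambda>n. wcomp u \<psi> ((wcomp u \<psi> ^^ r n) e)) \<longlonglongrightarrow> l"
    by (rule compact_operator_subseq[OF comp])
  have "u_inf u \<psi> z = fock_fun l z" for z
  proof (rule LIMSEQ_unique)
    \<comment> \<open>Applying the operator once more moves the index from \<open>r n\<close> to
      \<open>Suc (r n)\<close>.\<close>
    show "(\<lambda>n. orbit_prod u \<psi> (Suc (r n)) z) \<longlonglongrightarrow> u_inf u \<psi> z"
      using LIMSEQ_subseq_LIMSEQ[OF LIMSEQ_Suc[OF lim] r(1)] by (simp add: o_def)
    show "(\<lambda>n. orbit_prod u \<psi> (Suc (r n)) z) \<longlonglongrightarrow> fock_fun l z"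
      using tendsto_fock_fun[OF r(2), of z] e[of "Suc (r _)" z] by simp
  qed
  then have "u_inf u \<psi> = fock_fun l" by blast
  then show ?thesis using fock_fun[of l] by simp
qed

text \<open>
  With \<open>P = wcomp (u_inf u \<psi>) (\<lambda>_. z\<^sub>0)\<close> one has \<open>T P = P\<close>, hence \<open>T\<^sup>n\<^sup>+\<^sup>1 - P = T (T\<^sup>n - P)\<close>. Applied to
  near-maximizers of the operator norms, \<open>T\<^sup>n - P\<close> gives a bounded sequence that tends to \<open>0\<close>
  pointwise, and the compact \<open>T\<close> turns this into norm convergence.
\<close>

lemma wcomp_powers_tendsto:
  assumes maps: "maps_fock u \<psi>" and comp: "compact_operator (wcomp u \<psi>)"
    and pb: "power_bounded (wcomp u \<psi>)"
    and lim: "\<And>z. (\<lambda>n. orbit_prod u \<psi> n z) \<longlonglongrightarrow> u_inf u \<psi> z"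
    and orbit: "\<And>z. (\<lambda>n. (\<psi> ^^ n) z) \<longlonglongrightarrow> z\<^sub>0"
  shows "(\<lambda>n. onorm (\<lambda>f. (wcomp u \<psi> ^^ n) f - wcomp (u_inf u \<psi>) (\<lambda>_. z\<^sub>0) f)) \<longlonglongrightarrow> 0"
proof -
  define T where "T = wcomp u \<psi>"
  define P where "P = wcomp (u_inf u \<psi>) (\<lambda>_. z\<^sub>0)"
  have inf: "u_inf u \<psi> \<in> fock_space" by (rule u_inf_in_fock_space[OF maps comp pb lim])
  have T: "bounded_linear T" using comp by (simp add: compact_operator_def T_def)
  have P: "bounded_linear P" unfolding P_def by (rule wcomp_const_symbol(2)[OF inf])
  have P_fun: "fock_fun (P f) z = u_inf u \<psi> z * fock_fun f z\<^sub>0" for f z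
    unfolding P_def by (rule fock_fun_wcomp[OF wcomp_const_symbol(1)[OF inf]])
  have T_fun: "fock_fun (T f) z = u z * fock_fun f (\<psi> z)" for f z
    unfolding T_def by (rule fock_fun_wcomp[OF maps])
  have inv: "u_inf u \<psi> z = u z * u_inf u \<psi> (\<psi> z)" for z
    by (rule LIMSEQ_unique[OF LIMSEQ_Suc[OF lim]]) (simp add: orbit_prod_Suc tendsto_mult_left lim)
  have TP: "T (P f) = P f" for f
  proof -
    have "fock_fun (T (P f)) z = fock_fun (P f) z" for z
      by (simp add: P_fun T_fun inv[of z])
    then show ?thesis by (simp add: fock_fun_inject[symmetric] fun_eq_iff)
  qed
  define D where "D n f = (T ^^ n) f - P f" for n f
  have D: "bounded_linear (D n)" for n
    unfolding D_def by (intro bounded_linear_sub bounded_linear_funpow T P)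
  have DSuc: "D (Suc n) f = T (D n f)" for n f
    by (simp add: D_def linear_diff[OF bounded_linear.linear[OF T]] TP)
  \<comment> \<open>The near-maximizers belong to \<open>D (Suc n)\<close>, not \<open>D n\<close>,
    so that by \<open>DSuc\<close> the compact \<open>T\<close> acts on the bounded vectors
    \<open>D n (f n)\<close>.\<close>
  have "\<exists>f. norm f \<le> 1 \<and> onorm (D (Suc n)) \<le> 2 * norm (D (Suc n) f)" for n
    using onorm_near_maximizer[OF D] by blast
  then obtain f where f: "\<And>n. norm (f n) \<le> 1"
    and max: "\<And>n. onorm (D (Suc n)) \<le> 2 * norm (T (D n (f n)))"
    unfolding DSuc by metis
  obtain C where C: "0 \<le> C" "\<And>n f. norm ((T ^^ n) f) \<le> C * norm f"
    using power_bounded_bound[OF pb[folded T_def]] by blast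
  obtain L where L: "\<And>f w. norm f \<le> 1 \<Longrightarrow> w \<in> cball z\<^sub>0 1 \<Longrightarrow>
      cmod (fock_fun f w - fock_fun f z\<^sub>0) \<le> L * cmod (w - z\<^sub>0)"
    using fock_fun_lipschitz[of z\<^sub>0] by metis
  have "(\<lambda>n. T (D n (f n))) \<longlonglongrightarrow> 0"
  proof (rule compact_operator_pointwise_null[where h = "\<lambda>n. D n (f n)"])
    show "compact_operator T" unfolding T_def by (rule comp)
    show "norm (D n (f n)) \<le> C + onorm P" for n
    proof -
      have "norm ((T ^^ n) (f n)) \<le> C"
        using C(2)[of n "f n"] mult_left_mono[OF f C(1), of n] by simp
      moreover have "norm (P (f n)) \<le> onorm P"
        using onorm[OF P, of "f n"] mult_left_mono[OF f onorm_pos_le[OF P], of n] by simp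
      ultimately show ?thesis
        unfolding D_def using norm_triangle_ineq4[of "(T ^^ n) (f n)" "P (f n)"] by linarith
    qed
    fix z
    have lim0: "(\<lambda>n. (\<psi> ^^ n) y - z\<^sub>0) \<longlonglongrightarrow> 0" for y
      using orbit by (simp add: LIM_zero_iff)
    \<comment> \<open>Since \<open>f n\<close> changes with \<open>n\<close>, continuity of a single
      function does not suffice here; the uniform constant \<open>L\<close> does.\<close>
    have "(\<lambda>n. fock_fun (f n) ((\<psi> ^^ n) y) - fock_fun (f n) z\<^sub>0) \<longlonglongrightarrow> 0" for y
    proof (rule Lim_null_comparison)
      have "\<forall>\<^sub>F n in sequentially. dist ((\<psi> ^^ n) y) z\<^sub>0 < 1"
        using orbit[of y] unfolding tendsto_iff by simp
      then show "\<forall>\<^sub>F n in sequentially. cmod (fock_fun (f n) ((\<psi> ^^ n) y) - fock_fun (f n) z\<^sub>0)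
          \<le> L * cmod ((\<psi> ^^ n) y - z\<^sub>0)"
        by eventually_elim (auto intro!: L f simp: dist_commute)
      show "(\<lambda>n. L * cmod ((\<psi> ^^ n) y - z\<^sub>0)) \<longlonglongrightarrow> 0"
        by (intro tendsto_mult_right_zero tendsto_norm_zero lim0)
    qed
    then have 1: "(\<lambda>n. orbit_prod u \<psi> n y * (fock_fun (f n) ((\<psi> ^^ n) y) - fock_fun (f n) z\<^sub>0)) \<longlonglongrightarrow> 0" for y
      using tendsto_mult[OF lim[of y]] by fastforce
    have 2: "(\<lambda>n. (orbit_prod u \<psi> n y - u_inf u \<psi> y) * fock_fun (f n) z\<^sub>0) \<longlonglongrightarrow> 0" for y
    proof (rule Lim_null_comparison)
      show "\<forall>\<^sub>F n in sequentially. cmod ((orbit_prod u \<psi> n y - u_inf u \<psi> y) * fock_fun (f n) z\<^sub>0)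
          \<le> cmod (orbit_prod u \<psi> n y - u_inf u \<psi> y) * exp ((cmod z\<^sub>0)\<^sup>2 / 2)"
      proof (intro always_eventually allI)
        fix n
        have "norm (f n) * exp ((cmod z\<^sub>0)\<^sup>2 / 2) \<le> 1 * exp ((cmod z\<^sub>0)\<^sup>2 / 2)"
          by (intro mult_right_mono f) auto
        then have "cmod (fock_fun (f n) z\<^sub>0) \<le> exp ((cmod z\<^sub>0)\<^sup>2 / 2)"
          using fock_fun_le_norm[of "f n" z\<^sub>0] by linarith
        then show "cmod ((orbit_prod u \<psi> n y - u_inf u \<psi> y) * fock_fun (f n) z\<^sub>0)
          \<le> cmod (orbit_prod u \<psi> n y - u_inf u \<psi> y) * exp ((cmod z\<^sub>0)\<^sup>2 / 2)"
          by (simp add: norm_mult mult_left_mono)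
      qed
      show "(\<lambda>n. cmod (orbit_prod u \<psi> n y - u_inf u \<psi> y) * exp ((cmod z\<^sub>0)\<^sup>2 / 2)) \<longlonglongrightarrow> 0"
        using lim[of y] by (intro tendsto_mult_left_zero tendsto_norm_zero) (simp add: LIM_zero_iff)
    qed
    \<comment> \<open>With \<open>p n\<close> for the orbit product at \<open>y\<close>, the value
      is \<open>p n * (f n (\<psi>^n y) - f n z\<^sub>0) + (p n - u_inf u \<psi> y) * f n
      z\<^sub>0\<close>, the sum of \<open>1\<close> and \<open>2\<close>.\<close>
    have "(\<lambda>n. fock_fun (D n (f n)) y) \<longlonglongrightarrow> 0" for y
      using tendsto_add[OF 1[of y] 2[of y]]
      by (simp add: D_def minus_fock.rep_eq P_fun fock_fun_wcomp_funpow[OF maps] T_def algebra_simps)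
    then show "(\<lambda>n. fock_fun (T (D n (f n))) z) \<longlonglongrightarrow> 0"
      by (simp add: T_fun tendsto_mult_right_zero)
  qed
  then have "(\<lambda>n. 2 * norm (T (D n (f n)))) \<longlonglongrightarrow> 0"
    by (intro tendsto_mult_right_zero tendsto_norm_zero)
  then have "(\<lambda>n. onorm (D (Suc n))) \<longlonglongrightarrow> 0"
    by (rule Lim_null_comparison[rotated]) (simp add: max onorm_pos_le[OF D] always_eventually)
  then have "(\<lambda>n. onorm (D n)) \<longlonglongrightarrow> 0" by (rule LIMSEQ_imp_Suc)
  then show ?thesis by (simp add: D_def[abs_def] T_def P_def)
qed

text \<open>Convergence of the products, \<open>maps_fock\<close> and \<open>bounded_linear\<close>
  are among the conclusions because \<open>lim\<close>, \<open>Fock\<close> and \<open>onorm\<close>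
  could otherwise return unspecified values; they make the final limit a statement about the
  intended operator.\<close>

theorem theorem4p3:
  fixes u \<psi> :: "complex \<Rightarrow> complex"
  assumes "u holomorphic_on UNIV" and "\<psi> holomorphic_on UNIV"
    and "maps_fock u \<psi>"
    and "compact_operator (wcomp u \<psi>)"
    and "power_bounded (wcomp u \<psi>)"
    and "\<forall>z. u z \<noteq> 0"
  shows "(\<exists>a b. (\<forall>z. \<psi> z = a * z + b) \<and> cmod a < 1) \<and>
    (\<forall>a b z\<^sub>0. (\<forall>z. \<psi> z = a * z + b) \<and> cmod a < 1 \<and> z\<^sub>0 = b / (1 - a) \<and> u z\<^sub>0 = 1 \<longrightarrow>
      (\<forall>z. convergent (\<lambda>n. orbit_prod u \<psi> n z)) \<and>
      maps_fock (u_inf u \<psi>) (\<lambda>_. z\<^sub>0) \<and>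
      bounded_linear (wcomp (u_inf u \<psi>) (\<lambda>_. z\<^sub>0)) \<and>
      (\<lambda>n. onorm (\<lambda>f. (1 / real n) *\<^sub>R (\<Sum>k=1..n. (wcomp u \<psi> ^^ k) f)
                       - wcomp (u_inf u \<psi>) (\<lambda>_. z\<^sub>0) f)) \<longlonglongrightarrow> 0)"
proof (intro conjI allI impI; (elim conjE)?)
  show "\<exists>a b. (\<forall>z. \<psi> z = a * z + b) \<and> cmod a < 1"
    using wcomp_symbol_affine[OF assms(1-4)] assms(6) by metis
next
  fix a b z\<^sub>0
  assume \<psi>: "\<forall>z. \<psi> z = a * z + b" and a: "cmod a < 1" and z0: "z\<^sub>0 = b / (1 - a)" and u0: "u z\<^sub>0 = 1"
  have orbit: "(\<psi> ^^ n) z = z\<^sub>0 + a ^ n * (z - z\<^sub>0)" for n z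
    using \<psi> a z0 by (intro funpow_affine) auto
  have lim: "(\<lambda>n. orbit_prod u \<psi> n z) \<longlonglongrightarrow> u_inf u \<psi> z" for z
    by (rule tendsto_orbit_prod[OF assms(1) u0 a orbit])
  then show "convergent (\<lambda>n. orbit_prod u \<psi> n z)" for z
    by (auto simp: convergent_def)
  have inf: "u_inf u \<psi> \<in> fock_space"
    by (rule u_inf_in_fock_space[OF assms(3-5) lim])
  show "maps_fock (u_inf u \<psi>) (\<lambda>_. z\<^sub>0)" and P: "bounded_linear (wcomp (u_inf u \<psi>) (\<lambda>_. z\<^sub>0))"
    by (rule wcomp_const_symbol[OF inf])+
  have "(\<lambda>n. z\<^sub>0 + a ^ n * (z - z\<^sub>0)) \<longlonglongrightarrow> z\<^sub>0 + 0 * (z - z\<^sub>0)" for z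
    using a by (intro tendsto_intros LIMSEQ_power_zero)
  then have "(\<lambda>n. (\<psi> ^^ n) z) \<longlonglongrightarrow> z\<^sub>0" for z by (simp add: orbit)
  then show "(\<lambda>n. onorm (\<lambda>f. (1 / real n) *\<^sub>R (\<Sum>k=1..n. (wcomp u \<psi> ^^ k) f)
      - wcomp (u_inf u \<psi>) (\<lambda>_. z\<^sub>0) f)) \<longlonglongrightarrow> 0"
    using assms(4) by (intro onorm_cesaro_mean_null[OF _ P] wcomp_powers_tendsto assms(3-5) lim)
      (simp_all add: compact_operator_def)
qed

end
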